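(* Let $\mathbb{F}$ be a field that is a proper extension of $\mathbb{F}_2$, and let $\mathcal{A}$ be a unital (not necessarily associative) $\mathbb{F}$-algebra of dimension $3$. Then $l(\mathcal{A})=1$ if and only if there is a basis $\{a_1=1_{\mathcal{A}},a_2,a_3\}$ of $\mathcal{A}$ whose multiplication table satisfies the following conditions: (i) $a_2^2\equiv\delta_2a_2$ and $a_3^2\equiv\delta_3a_3$ for some $\delta_2,\delta_3\in\mathbb{F}_2$; (ii) $a_2a_3\equiv\beta_2a_2+\beta_3^{*}a_3$ and $a_3a_2\equiv\beta_3a_3+\beta_2^{*}a_2$ for some $\beta_2,\beta_2^{*},\beta_3,\beta_3^{*}\in\mathbb{F}$ with $\beta_2+\beta_2^{*}+\delta_3=0=\beta_3+\beta_3^{*}+\delta_2$.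
   Context: For $a,b\in\mathcal{A}$, $a\equiv b$ means $a-b\in\mathbb{F}1_{\mathcal{A}}$. For a finite subset $S\subseteq\mathcal{A}$, a word in $S$ is any product (with any bracketing) of finitely many elements of $S$; its length is the number of letters different from $1_{\mathcal{A}}$ in the product; $1_{\mathcal{A}}$ is by convention a word of length $0$ in any $S$. $\mathcal{L}_i(S)$ is the $\mathbb{F}$-span of all words in $S$ of length at most $i$, and $\mathrm{alg}(S)=\bigcup_{i\ge 0}\mathcal{L}_i(S)$ is the subalgebra generated by $S$ (it contains $1_{\mathcal{A}}$). The length of $S$ is $l(S)=\min\{k\in\mathbb{Z}_{\ge 0}:\mathrm{alg}(S)=\mathcal{L}_k(S)\}$, and $l(\mathcal{A})=\max\{l(S): S \text{ finite},\ \mathrm{alg}(S)=\mathcal{A}\}$. *)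

theory Defs
  imports "HOL-Computational_Algebra.Computational_Algebra"
begin

text \<open>Unital algebras over a field with bilinear, not necessarily associative or commutative,
  multiplication.  The underlying vector space is the whole type \<open>'a\<close>.\<close>

locale unital_algebra = vector_space scale
  for scale :: "'f::field \<Rightarrow> 'a::ab_group_add \<Rightarrow> 'a" +
  fixes mult :: "'a \<Rightarrow> 'a \<Rightarrow> 'a"
    and one :: 'a
  assumes mult_add_left: "mult (x + y) z = mult x z + mult y z"
    and mult_add_right: "mult x (y + z) = mult x y + mult x z"
    and mult_scale_left: "mult (scale c x) y = scale c (mult x y)"
    and mult_scale_right: "mult x (scale c y) = scale c (mult x y)"
    and one_mult: "mult one x = x"
    and mult_one: "mult x one = x"

text \<open>A nonempty product of letters together with its bracketing.\<close>

datatype 'a bracketed_word = Letter 'a | Prod "'a bracketed_word" "'a bracketed_word"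

context unital_algebra
begin

definition is_basis :: "'a set \<Rightarrow> bool" where
  "is_basis B \<longleftrightarrow> independent B \<and> span B = UNIV"

definition eqv :: "'a \<Rightarrow> 'a \<Rightarrow> bool" where
  "eqv a b \<longleftrightarrow> a - b \<in> range (\<lambda>c. scale c one)"

primrec word_value :: "'a bracketed_word \<Rightarrow> 'a" where
  "word_value (Letter a) = a"
| "word_value (Prod u v) = mult (word_value u) (word_value v)"

primrec word_length :: "'a bracketed_word \<Rightarrow> nat" where
  "word_length (Letter a) = (if a = one then 0 else 1)"
| "word_length (Prod u v) = word_length u + word_length v"

text \<open>The unit is inserted separately: it is a word of length \<open>0\<close> in every \<open>S\<close>,
  even if it is not a letter.\<close>

definition words_upto :: "nat \<Rightarrow> 'a set \<Rightarrow> 'a set" where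
  "words_upto i S =
     insert one {word_value w | w. set_bracketed_word w \<subseteq> S \<and> word_length w \<le> i}"

definition \<L> :: "nat \<Rightarrow> 'a set \<Rightarrow> 'a set" where
  "\<L> i S = span (words_upto i S)"

definition alg :: "'a set \<Rightarrow> 'a set" where
  "alg S = (\<Union>i. \<L> i S)"

definition set_length :: "'a set \<Rightarrow> nat" where
  "set_length S = (LEAST k. alg S = \<L> k S)"

text \<open>\<^const>\<open>Max\<close> is only meaningful for a finite nonempty set of lengths, which
  is what a finite-dimensional algebra provides.\<close>

definition alg_length :: nat where
  "alg_length = Max {set_length S | S. finite S \<and> alg S = UNIV}"

end

end

theory Submission
  imports Defs
begin

text \<open>The key is that a three-dimensional unital algebra has length one exactly when it is
  quadratic, that is, when every square \<open>a\<^sup>2\<close> lies in the span of \<open>1\<close> and \<open>a\<close>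
  (\<open>alg_length_1_iff_quadratic\<close>).  If \<open>a\<^sup>2\<close> lies outside that span, then
  \<open>1, a, a\<^sup>2\<close> is a basis, so the single element \<open>a\<close> generates the algebra, but not with words
  of length at most one.  Conversely, in a quadratic algebra the span of \<open>1\<close> and one element is
  a subalgebra, hence a generating set must contain two letters that are independent modulo
  scalars, and together with \<open>1\<close> these already span.  That the maximum of all lengths behaves
  as expected rests on the bound of two for the length of every generating set: if the words
  of length at most one do not span, some nonscalar letter and some product of two letters
  complete \<open>1\<close> to a basis.

  Being quadratic is then read off a multiplication table modulo scalars
  (\<open>quadratic_iff_coefficients\<close>).  Let \<open>1, b, c\<close> be a basis with \<open>b\<^sup>2 \<equiv> d b\<close>, \<open>c\<^sup>2 \<equiv> e c\<close>,
  \<open>b c \<equiv> p b + q' c\<close> and \<open>c b \<equiv> q c + p' b\<close>.  Modulo scalars, the square of \<open>x b + y c\<close> is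
  \<open>x (x d + y (p + p')) b + y (y e + x (q + q')) c\<close>, and it has to be a multiple of
  \<open>x b + y c\<close>.  For nonzero \<open>x\<close> and \<open>y\<close> this says that the two bracketed factors agree; since the
  field has an element other than \<open>0\<close> and \<open>1\<close>, two such choices of \<open>(x, y)\<close> force
  \<open>p + p' = e\<close> and \<open>q + q' = d\<close>, and these equations suffice for all \<open>x\<close> and \<open>y\<close>.
  In characteristic two they are the two vanishing conditions of the theorem.  Finally, a basis
  vector with \<open>b\<^sup>2 \<equiv> k b\<close> and \<open>k \<noteq> 0\<close> can be divided by \<open>k\<close>, which normalizes the
  diagonal coefficients to \<open>0\<close> or \<open>1\<close>.\<close>

section \<open>Words and generated subalgebras\<close>

context unital_algebra
begin

lemma mult_span_closed:
  assumes prod: "\<And>x y. x \<in> A \<Longrightarrow> y \<in> B \<Longrightarrow> mult x y \<in> W" and W: "subspace W"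
    and x: "x \<in> span A" and y: "y \<in> span B"
  shows "mult x y \<in> W"
proof -
  have left: "mult x b \<in> W" if "b \<in> B" for b
    using x
  proof (induction rule: span_induct_alt)
    case base
    have "mult 0 b = 0" using mult_scale_left[of 0 0 b] by simp
    then show ?case using W subspace_0 by simp
  next
    case (step c a z)
    then show ?case using W prod that
      by (simp add: mult_add_left mult_scale_left subspace_add subspace_scale)
  qed
  show ?thesis
    using y
  proof (induction rule: span_induct_alt)
    case base
    have "mult x 0 = 0" using mult_scale_right[of x 0 0] by simp
    then show ?case using W subspace_0 by simp
  next
    case (step c b z)
    then show ?case using W left
      by (simp add: mult_add_right mult_scale_right subspace_add subspace_scale)
  qed
qed

lemma word_value_length_0: "word_length w = 0 \<Longrightarrow> word_value w = one"
  by (induction w) (auto simp: one_mult split: if_splits)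

text \<open>A product of total length at most one has a factor of length zero, whose value is the unit,
  so only the other factor matters.\<close>

lemma word_value_length_1:
  "word_length w \<le> 1 \<Longrightarrow> word_value w \<in> insert one (set_bracketed_word w)"
proof (induction w)
  case (Prod u v)
  then have "word_length u = 0 \<or> word_length v = 0" by auto
  then show ?case
    using Prod by (elim disjE) (auto simp: word_value_length_0 one_mult mult_one)
qed simp

lemma Lspan_0: "\<L> 0 S = span {one}"
proof -
  have "words_upto 0 S = {one}"
    by (auto simp: words_upto_def word_value_length_0)
  then show ?thesis by (simp add: \<L>_def)
qed

lemma letter_in_words_upto: "s \<in> S \<Longrightarrow> i \<ge> 1 \<Longrightarrow> s \<in> words_upto i S"
  unfolding words_upto_def by (auto intro!: exI[of _ "Letter s"])

lemma Lspan_1: "\<L> 1 S = span (insert one S)"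
proof -
  have "words_upto 1 S = insert one S"
  proof
    show "words_upto 1 S \<subseteq> insert one S"
    proof
      fix x assume "x \<in> words_upto 1 S"
      then consider "x = one"
        | w where "x = word_value w" "set_bracketed_word w \<subseteq> S" "word_length w \<le> 1"
        by (auto simp: words_upto_def)
      then show "x \<in> insert one S"
        using word_value_length_1 by cases blast+
    qed
    show "insert one S \<subseteq> words_upto 1 S"
      using letter_in_words_upto[of _ S 1] by (auto simp: words_upto_def)
  qed
  then show ?thesis by (simp add: \<L>_def)
qed

lemma prod_in_Lspan_2:
  assumes "s \<in> S" "t \<in> S"
  shows "mult s t \<in> \<L> 2 S"
  unfolding \<L>_def words_upto_def using assms
  by (intro span_base) (auto intro!: exI[of _ "Prod (Letter s) (Letter t)"])

lemma Lspan_subset_alg: "\<L> i S \<subseteq> alg S"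
  by (auto simp: alg_def)

lemma alg_subset:
  assumes W: "subspace W" and "one \<in> W" "S \<subseteq> W"
    and closed: "\<And>x y. x \<in> W \<Longrightarrow> y \<in> W \<Longrightarrow> mult x y \<in> W"
  shows "alg S \<subseteq> W"
proof -
  have "word_value w \<in> W" if "set_bracketed_word w \<subseteq> S" for w
    using that by (induction w) (use assms in auto)
  then have "words_upto i S \<subseteq> W" for i
    using \<open>one \<in> W\<close> by (auto simp: words_upto_def)
  then have "\<L> i S \<subseteq> W" for i
    unfolding \<L>_def using W by (rule span_minimal)
  then show ?thesis
    by (auto simp: alg_def)
qed

lemma alg_subset_span:
  assumes prod: "\<And>s t. s \<in> T \<Longrightarrow> t \<in> T \<Longrightarrow> mult s t \<in> span (insert one T)"
    and "S \<subseteq> span (insert one T)"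
  shows "alg S \<subseteq> span (insert one T)"
proof (rule alg_subset)
  fix x y assume "x \<in> span (insert one T)" "y \<in> span (insert one T)"
  moreover have "mult s t \<in> span (insert one T)"
    if "s \<in> insert one T" "t \<in> insert one T" for s t
    using that prod by (auto simp: one_mult mult_one intro: span_base)
  ultimately show "mult x y \<in> span (insert one T)"
    using mult_span_closed by blast
qed (use assms in \<open>auto intro: span_base\<close>)

text \<open>The scalars form a subalgebra, so when they are not everything they cannot contain all of a
  generating set.\<close>

lemma generators_not_scalar:
  assumes "alg S = UNIV" and "span {one} \<noteq> UNIV"
  obtains s where "s \<in> S" "s \<notin> span {one}"
  using alg_subset_span[of "{}" S] assms by auto

section \<open>Length one in dimension three\<close>

lemma one_nonzero:
  assumes "dim (UNIV :: 'a set) = 3"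
  shows "one \<noteq> 0"
proof
  assume "one = 0"
  have "(UNIV :: 'a set) \<subseteq> span {}"
  proof
    fix x
    show "x \<in> span {}"
      using one_mult[of x] mult_scale_left[of 0 0 x] \<open>one = 0\<close> by simp
  qed
  then have "dim (UNIV :: 'a set) \<le> card ({} :: 'a set)"
    by (rule dim_le_card) simp
  then show False using assms by simp
qed

lemma span_two_proper:
  assumes "dim (UNIV :: 'a set) = 3"
  shows "span {a, b} \<noteq> UNIV"
proof
  assume "span {a, b} = UNIV"
  then have "dim (UNIV :: 'a set) \<le> card {a, b}"
    by (intro dim_le_card) auto
  also have "\<dots> \<le> 2" by (simp add: card_insert_if)
  finally show False using assms by simp
qed

lemma basis_one_extend:
  assumes dim: "dim (UNIV :: 'a set) = 3" and b: "b \<notin> span {one}" and c: "c \<notin> span {one, b}"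
  shows "distinct [one, b, c]" and "is_basis {one, b, c}"
proof -
  show distinct: "distinct [one, b, c]"
    using b c by (auto simp: span_base)
  have "independent {one, b}"
    using independent_insertI[OF b] one_nonzero[OF dim] by (simp add: insert_commute)
  then have indep: "independent {one, b, c}"
    using independent_insertI[OF c] by (simp add: insert_commute)
  obtain B where B: "independent B" "UNIV \<subseteq> span B" "card B = dim (UNIV :: 'a set)"
    by (rule basis_exists)
  have "finite B" using B(3) dim by (intro card_ge_0_finite) simp
  then interpret finite_dimensional_vector_space scale B
    using B(1,2) \<open>finite B\<close> by unfold_locales auto
  have "UNIV \<subseteq> span {one, b, c}"
    using indep distinct dim by (intro card_ge_dim_independent) auto
  then show "is_basis {one, b, c}"
    using indep by (auto simp: is_basis_def)
qed

lemma set_length_le: "alg S = \<L> k S \<Longrightarrow> set_length S \<le> k"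
  unfolding set_length_def by (rule Least_le)

text \<open>If the letters together with the unit do not span, their span is not closed under
  multiplication, since the set generates.  Hence some product of two letters leaves it.  This
  product, a nonscalar letter and the unit then form a basis consisting of words of length at
  most two.\<close>

lemma generating_Lspan_2:
  assumes dim: "dim (UNIV :: 'a set) = 3" and gen: "alg S = UNIV"
  shows "\<L> 2 S = UNIV"
proof (cases "span (insert one S) = UNIV")
  case True
  have sub: "insert one S \<subseteq> words_upto 2 S"
    using letter_in_words_upto[of _ S 2] by (auto simp: words_upto_def)
  show ?thesis
    using True span_mono[OF sub] by (auto simp: \<L>_def)
next
  case False
  have "span {one} \<noteq> UNIV"
    using span_two_proper[OF dim, of one one] by simp
  then obtain s where s: "s \<in> S" "s \<notin> span {one}"
    using generators_not_scalar[OF gen] by blast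
  obtain t u where tu: "t \<in> S" "u \<in> S" "mult t u \<notin> span (insert one S)"
    using alg_subset_span[of S S] gen False by (auto intro: span_base)
  have "mult t u \<notin> span {one, s}"
    using tu s span_mono[of "{one, s}" "insert one S"] by auto
  then have "span {one, s, mult t u} = UNIV"
    using basis_one_extend[OF dim s(2)] by (simp add: is_basis_def)
  moreover have "{one, s, mult t u} \<subseteq> \<L> 2 S"
    using s tu prod_in_Lspan_2 letter_in_words_upto[of s S 2]
    by (auto simp: \<L>_def words_upto_def intro: span_base)
  then have "span {one, s, mult t u} \<subseteq> \<L> 2 S"
    unfolding \<L>_def by (rule span_minimal) simp
  ultimately show ?thesis by auto
qed

text \<open>The lower bound comes from the words of length zero, which only span the line of the unit.\<close>

lemma set_length_generating:
  assumes dim: "dim (UNIV :: 'a set) = 3" and gen: "alg S = UNIV"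
  shows "set_length S \<in> {1..2}"
    and "set_length S = 1 \<longleftrightarrow> span (insert one S) = UNIV"
proof -
  have le: "set_length S \<le> 2"
    using set_length_le[of S 2] generating_Lspan_2[OF dim gen] gen by simp
  have attained: "\<L> (set_length S) S = UNIV"
    using LeastI[of "\<lambda>k. alg S = \<L> k S" 2] generating_Lspan_2[OF dim gen] gen
    unfolding set_length_def by simp
  have ge: "set_length S \<noteq> 0"
    using attained span_two_proper[OF dim, of one one] by (auto simp: Lspan_0)
  show "set_length S \<in> {1..2}"
    using le ge by auto
  show "set_length S = 1 \<longleftrightarrow> span (insert one S) = UNIV"
  proof
    assume "set_length S = 1"
    then show "span (insert one S) = UNIV" using attained by (simp only: Lspan_1)
  next
    assume "span (insert one S) = UNIV"
    then have "alg S = \<L> 1 S" using gen by (simp only: Lspan_1)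
    then show "set_length S = 1" using set_length_le ge by fastforce
  qed
qed

text \<open>The bounds make the set of lengths finite, and a vector space basis is a finite generating
  set.  So the maximum is taken over a finite nonempty set of positive numbers, and it is one if
  and only if all of them are one.\<close>

lemma alg_length_1_iff_generating:
  assumes dim: "dim (UNIV :: 'a set) = 3"
  shows "alg_length = 1 \<longleftrightarrow> (\<forall>S. finite S \<and> alg S = UNIV \<longrightarrow> span (insert one S) = UNIV)"
proof -
  define N where "N = {set_length S | S. finite S \<and> alg S = UNIV}"
  have N: "N \<subseteq> {1..2}"
    unfolding N_def using set_length_generating(1)[OF dim] by auto
  then have fin: "finite N" by (rule finite_subset) simp
  obtain B where B: "independent B" "UNIV \<subseteq> span B" "card B = dim (UNIV :: 'a set)"
    by (rule basis_exists)
  have "finite B" using B(3) dim by (intro card_ge_0_finite) simp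
  moreover have "span B \<subseteq> alg B"
    using subset_trans[OF span_mono[OF subset_insertI] Lspan_subset_alg[of 1 B, unfolded Lspan_1]] .
  then have "alg B = UNIV" using B(2) by auto
  ultimately have "N \<noteq> {}"
    unfolding N_def by auto
  have "alg_length = 1 \<longleftrightarrow> Max N = 1"
    by (simp only: alg_length_def N_def)
  also have "Max N = 1 \<longleftrightarrow> (\<forall>n\<in>N. n = 1)"
  proof
    assume "Max N = 1"
    then show "\<forall>n\<in>N. n = 1"
      using Max_ge[OF fin] N by fastforce
  next
    assume "\<forall>n\<in>N. n = 1"
    then show "Max N = 1"
      using Max_in[OF fin \<open>N \<noteq> {}\<close>] by simp
  qed
  also have "\<dots> \<longleftrightarrow> (\<forall>S. finite S \<and> alg S = UNIV \<longrightarrow> set_length S = 1)"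
    unfolding N_def by blast
  also have "\<dots> \<longleftrightarrow> (\<forall>S. finite S \<and> alg S = UNIV \<longrightarrow> span (insert one S) = UNIV)"
    by (simp only: set_length_generating(2)[OF dim] cong: conj_cong imp_cong)
  finally show ?thesis .
qed

text \<open>Both directions turn on whether a single nonscalar element \<open>a\<close> can generate: it does as
  soon as \<open>a\<^sup>2\<close> is outside the span of \<open>1\<close> and \<open>a\<close>, and otherwise that span is a proper
  subalgebra.\<close>

lemma alg_length_1_iff_quadratic:
  assumes dim: "dim (UNIV :: 'a set) = 3"
  shows "alg_length = 1 \<longleftrightarrow> (\<forall>a. mult a a \<in> span {one, a})"
proof
  assume "alg_length = 1"
  then have gen: "span (insert one S) = UNIV" if "finite S" "alg S = UNIV" for S
    using that alg_length_1_iff_generating[OF dim] by blast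
  show "\<forall>a. mult a a \<in> span {one, a}"
  proof (rule allI, rule ccontr)
    fix a assume a: "mult a a \<notin> span {one, a}"
    have "a \<notin> span {one}"
    proof
      assume "a \<in> span {one}"
      then obtain c where "a = scale c one" by (auto simp: span_singleton)
      then have "mult a a = scale c a" by (simp add: mult_scale_left one_mult)
      then show False using a by (auto intro: span_scale span_base)
    qed
    then have "span {one, a, mult a a} = UNIV"
      using basis_one_extend[OF dim _ a] by (simp add: is_basis_def)
    moreover have "{one, a, mult a a} \<subseteq> \<L> 2 {a}"
      using prod_in_Lspan_2[of a "{a}" a] letter_in_words_upto[of a "{a}" 2]
      by (auto simp: \<L>_def words_upto_def intro: span_base)
    then have "span {one, a, mult a a} \<subseteq> \<L> 2 {a}"
      unfolding \<L>_def by (rule span_minimal) simp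
    ultimately have "alg {a} = UNIV"
      using Lspan_subset_alg[of 2 "{a}"] by auto
    then show False
      using gen[of "{a}"] span_two_proper[OF dim, of one a] by simp
  qed
next
  assume quad: "\<forall>a. mult a a \<in> span {one, a}"
  have "span (insert one S) = UNIV" if gen: "alg S = UNIV" for S
  proof (rule ccontr)
    assume proper: "span (insert one S) \<noteq> UNIV"
    have "span {one} \<noteq> UNIV"
      using span_two_proper[OF dim, of one one] by simp
    then obtain s where s: "s \<in> S" "s \<notin> span {one}"
      using generators_not_scalar[OF gen] by blast
    have "t \<in> span {one, s}" if "t \<in> S" for t
    proof (rule ccontr)
      assume "t \<notin> span {one, s}"
      then have "span {one, s, t} = UNIV"
        using basis_one_extend[OF dim s(2)] by (simp add: is_basis_def)
      then show False
        using proper that s(1) span_mono[of "{one, s, t}" "insert one S"] by auto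
    qed
    then have "alg S \<subseteq> span {one, s}"
      using alg_subset_span[of "{s}" S] quad by auto
    then show False
      using gen span_two_proper[OF dim, of one s] by auto
  qed
  then show "alg_length = 1"
    using alg_length_1_iff_generating[OF dim] by blast
qed

section \<open>Multiplication tables modulo scalars\<close>

lemma eqv_iff: "eqv x y \<longleftrightarrow> x - y \<in> span {one}"
  by (simp add: eqv_def span_singleton)

lemma eqv_sym: "eqv x y \<Longrightarrow> eqv y x"
  unfolding eqv_iff using span_neg[of "x - y"] by simp

lemma eqv_trans: "eqv x y \<Longrightarrow> eqv y z \<Longrightarrow> eqv x z"
  unfolding eqv_iff using span_add[of "x - y" "{one}" "y - z"] by simp

lemma eqv_add: "eqv x x' \<Longrightarrow> eqv y y' \<Longrightarrow> eqv (x + y) (x' + y')"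
  unfolding eqv_iff using span_add[of "x - x'" "{one}" "y - y'"] by (simp add: add_diff_add)

lemma eqv_scale: "eqv x y \<Longrightarrow> eqv (scale c x) (scale c y)"
  unfolding eqv_iff using span_scale[of "x - y" "{one}" c] by (simp add: scale_right_diff_distrib)

lemma in_span_one_iff: "x \<in> span {one, a} \<longleftrightarrow> (\<exists>k. eqv x (scale k a))"
  using span_breakdown_eq[of x a "{one}"] by (simp add: eqv_iff insert_commute)

lemma in_span_basis_iff: "x \<in> span {one, b, c} \<longleftrightarrow> (\<exists>u v. eqv x (scale u b + scale v c))"
proof -
  have "x \<in> span {one, b, c} \<longleftrightarrow> (\<exists>u. x - scale u b \<in> span {one, c})"
    using span_breakdown_eq[of x b "{one, c}"] by (simp add: insert_commute)
  also have "\<dots> \<longleftrightarrow> (\<exists>u v. eqv x (scale u b + scale v c))"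
    by (simp only: in_span_one_iff eqv_iff diff_diff_add)
  finally show ?thesis .
qed

lemma eqv_coordinates_unique:
  assumes b: "b \<notin> span {one}" and c: "c \<notin> span {one, b}"
    and e: "eqv (scale u b + scale v c) (scale u' b + scale v' c)"
  shows "u = u' \<and> v = v'"
proof -
  have 1: "scale (u - u') b + scale (v - v') c \<in> span {one}"
    using e by (simp add: eqv_iff scale_left_diff_distrib algebra_simps)
  have "v = v'"
  proof (rule ccontr)
    assume ne: "v \<noteq> v'"
    have "scale (u - u') b + scale (v - v') c - scale (u - u') b \<in> span {one, b}"
      using 1 span_mono[of "{one}" "{one, b}"] by (intro span_diff span_scale) (auto intro: span_base)
    then have "scale (inverse (v - v')) (scale (v - v') c) \<in> span {one, b}"
      by (simp only: add_diff_cancel_left' span_scale)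
    moreover have "scale (inverse (v - v')) (scale (v - v') c) = c" using ne by simp
    ultimately show False using c by metis
  qed
  moreover have "u = u'"
  proof (rule ccontr)
    assume ne: "u \<noteq> u'"
    have "scale (u - u') b \<in> span {one}"
      using 1 \<open>v = v'\<close> by simp
    then have "scale (inverse (u - u')) (scale (u - u') b) \<in> span {one}"
      by (rule span_scale)
    moreover have "scale (inverse (u - u')) (scale (u - u') b) = b" using ne by simp
    ultimately show False using b by metis
  qed
  ultimately show ?thesis by simp
qed

text \<open>Since the unit commutes with everything, \<open>(v + z)\<^sup>2 = v\<^sup>2 + 2 z v + z\<^sup>2\<close> for a scalar
  \<open>z\<close>.  So adding a scalar does not affect whether an element satisfies a quadratic equation, and
  it is enough to look at one representative modulo scalars.\<close>

lemma quadratic_add_scalar: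
  assumes "eqv a v" and v: "eqv (mult v v) (scale k v)"
  shows "mult a a \<in> span {one, a}"
proof -
  obtain z where "a - v = scale z one"
    using assms(1) by (auto simp: eqv_def)
  then have a: "a = v + scale z one"
    by (simp add: diff_eq_eq add.commute)
  have "mult a a = mult v v + (scale z v + scale z v) + scale (z * z) one"
    by (simp add: a mult_add_left mult_add_right mult_scale_left mult_scale_right one_mult mult_one
        scale_right_distrib add_ac)
  moreover have v': "v \<in> span {one, a}"
    using span_diff[of a "{one, a}" "scale z one"] by (simp add: a span_base span_scale)
  moreover have "mult v v \<in> span {one, v}"
    using v in_span_one_iff by blast
  then have "mult v v \<in> span {one, a}"
    using v' span_minimal[of "{one, v}" "span {one, a}"] by (auto intro: span_base)
  ultimately show ?thesis
    by (auto intro!: span_add span_scale intro: span_base)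
qed

lemma square_coordinates:
  assumes "eqv (mult b b) (scale d b)" "eqv (mult c c) (scale e c)"
    and "eqv (mult b c) (scale p b + scale q' c)" "eqv (mult c b) (scale q c + scale p' b)"
  shows "eqv (mult (scale x b + scale y c) (scale x b + scale y c))
    (scale (x * (x * d + y * (p + p'))) b + scale (y * (y * e + x * (q + q'))) c)"
proof -
  have "mult (scale x b + scale y c) (scale x b + scale y c) =
      scale (x * x) (mult b b) + scale (y * y) (mult c c)
      + (scale (x * y) (mult b c) + scale (x * y) (mult c b))"
    by (simp add: mult_add_left mult_add_right mult_scale_left mult_scale_right algebra_simps)
  moreover have "eqv \<dots> (scale (x * x) (scale d b) + scale (y * y) (scale e c)
      + (scale (x * y) (scale p b + scale q' c) + scale (x * y) (scale q c + scale p' b)))"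
    using assms by (intro eqv_add eqv_scale)
  moreover have "\<dots> = scale (x * (x * d + y * (p + p'))) b + scale (y * (y * e + x * (q + q'))) c"
    by (simp add: scale_left_distrib scale_right_distrib algebra_simps)
  ultimately show ?thesis by simp
qed

text \<open>The coordinates of the square of \<open>x b + y c\<close> are compared with those of a multiple of
  \<open>x b + y c\<close>.  The case \<open>x = y = 1\<close> alone yields only \<open>d + (p + p') = e + (q + q')\<close>.  A second
  nonzero ratio \<open>y / x\<close> separates the two equations, and over the field with two elements there
  is no such ratio.\<close>

lemma quadratic_iff_coefficients:
  assumes field: "(UNIV :: 'f set) \<noteq> {0, 1}"
    and b: "b \<notin> span {one}" and c: "c \<notin> span {one, b}" and full: "span {one, b, c} = UNIV"
    and table: "eqv (mult b b) (scale d b)" "eqv (mult c c) (scale e c)"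
      "eqv (mult b c) (scale p b + scale q' c)" "eqv (mult c b) (scale q c + scale p' b)"
  shows "(\<forall>a. mult a a \<in> span {one, a}) \<longleftrightarrow> p + p' = e \<and> q + q' = d"
proof
  assume quad: "\<forall>a. mult a a \<in> span {one, a}"
  have coeff: "x * d + y * (p + p') = y * e + x * (q + q')" if "x \<noteq> 0" "y \<noteq> 0" for x y
  proof -
    obtain k where k: "eqv (mult (scale x b + scale y c) (scale x b + scale y c))
        (scale k (scale x b + scale y c))"
      using quad in_span_one_iff by blast
    have "eqv (scale (x * (x * d + y * (p + p'))) b + scale (y * (y * e + x * (q + q'))) c)
        (scale (k * x) b + scale (k * y) c)"
      using eqv_trans[OF eqv_sym[OF square_coordinates[OF table, of x y]] k]
      by (simp add: scale_right_distrib)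
    then have "x * (x * d + y * (p + p')) = x * k" "y * (y * e + x * (q + q')) = y * k"
      using eqv_coordinates_unique[OF b c] by (simp_all add: mult.commute)
    then show ?thesis using that by simp
  qed
  obtain r :: 'f where r: "r \<noteq> 0" "r \<noteq> 1" using field by auto
  \<comment> \<open>The difference of the instances \<open>(1, r)\<close> and \<open>(1, 1)\<close>.\<close>
  have "(r - 1) * (p + p') = (r - 1) * e"
    using coeff[of 1 1] coeff[of 1 r] r by (simp add: algebra_simps) algebra
  then have "p + p' = e" using r by simp
  then show "p + p' = e \<and> q + q' = d" using coeff[of 1 1] by simp
next
  assume coeff: "p + p' = e \<and> q + q' = d"
  show "\<forall>a. mult a a \<in> span {one, a}"
  proof
    fix a
    obtain x y where a: "eqv a (scale x b + scale y c)"
      using full in_span_basis_iff by blast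
    have "eqv (mult (scale x b + scale y c) (scale x b + scale y c))
        (scale (x * d + y * e) (scale x b + scale y c))"
      using square_coordinates[OF table, of x y] coeff
      by (simp add: scale_right_distrib algebra_simps)
    then show "mult a a \<in> span {one, a}"
      using quadratic_add_scalar a by blast
  qed
qed

text \<open>From \<open>a\<^sup>2 \<equiv> k a\<close> with \<open>k \<noteq> 0\<close> it follows that \<open>(a / k)\<^sup>2 \<equiv> a / k\<close>.  The span is left
  general because the two basis vectors are normalized one after the other: the first has to
  avoid the line of the unit, the second the plane of the unit and the first.\<close>

lemma normalized_outside:
  assumes quad: "mult a a \<in> span {one, a}" and a: "a \<notin> span T"
  obtains b d where "b \<notin> span T" "d \<in> {0, 1}" "eqv (mult b b) (scale d b)"
proof -
  obtain k where k: "eqv (mult a a) (scale k a)"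
    using quad in_span_one_iff by blast
  show thesis
  proof (cases "k = 0")
    case True
    then show thesis using that[of a 0] a k by simp
  next
    case False
    define b where "b = scale (inverse k) a"
    have "scale k b = a" using False by (simp add: b_def)
    then have "b \<notin> span T" using a span_scale[of b T k] by auto
    moreover have "eqv (mult b b) (scale 1 b)"
      using eqv_scale[OF k, of "inverse k * inverse k"] False
      by (simp add: b_def mult_scale_left mult_scale_right mult.assoc)
    ultimately show thesis using that[of b 1] by blast
  qed
qed

end

section \<open>Characterization by multiplication tables\<close>

theorem theorem4p4:
  fixes scale :: "'f::field \<Rightarrow> 'a::ab_group_add \<Rightarrow> 'a"
    and mult :: "'a \<Rightarrow> 'a \<Rightarrow> 'a"
    and one :: 'a
  assumes "CHAR('f) = 2" and "(UNIV :: 'f set) \<noteq> {0, 1}"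
    and "unital_algebra scale mult one"
    and "vector_space.dim scale (UNIV :: 'a set) = 3"
  shows "unital_algebra.alg_length scale mult one = 1 \<longleftrightarrow>
    (\<exists>a\<^sub>2 a\<^sub>3. distinct [one, a\<^sub>2, a\<^sub>3] \<and> unital_algebra.is_basis scale {one, a\<^sub>2, a\<^sub>3} \<and>
      (\<exists>\<delta>\<^sub>2 \<in> {0, 1}. \<exists>\<delta>\<^sub>3 \<in> {0, 1}.
        unital_algebra.eqv scale one (mult a\<^sub>2 a\<^sub>2) (scale \<delta>\<^sub>2 a\<^sub>2) \<and>
        unital_algebra.eqv scale one (mult a\<^sub>3 a\<^sub>3) (scale \<delta>\<^sub>3 a\<^sub>3) \<and>
        (\<exists>\<beta>\<^sub>2 \<beta>\<^sub>2' \<beta>\<^sub>3 \<beta>\<^sub>3'.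
          unital_algebra.eqv scale one (mult a\<^sub>2 a\<^sub>3) (scale \<beta>\<^sub>2 a\<^sub>2 + scale \<beta>\<^sub>3' a\<^sub>3) \<and>
          unital_algebra.eqv scale one (mult a\<^sub>3 a\<^sub>2) (scale \<beta>\<^sub>3 a\<^sub>3 + scale \<beta>\<^sub>2' a\<^sub>2) \<and>
          \<beta>\<^sub>2 + \<beta>\<^sub>2' + \<delta>\<^sub>3 = 0 \<and> \<beta>\<^sub>3 + \<beta>\<^sub>3' + \<delta>\<^sub>2 = 0)))"
proof -
  interpret unital_algebra scale mult one by fact
  note dim = assms(4)
  \<comment> \<open>In characteristic two a sum vanishes exactly when its two terms agree, which turns the
    vanishing conditions into equations with the diagonal coefficients.\<close>
  have two: "(1 :: 'f) + 1 = 0"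
    using of_nat_CHAR[where 'a = 'f] assms(1) by simp
  have neg: "x + y = 0 \<longleftrightarrow> x = y" for x y :: 'f
  proof -
    have "y + y = y * (1 + 1)" by (simp only: distrib_left mult_1_right)
    then have "y + y = 0" using two by simp
    then show ?thesis by (metis add_right_cancel)
  qed
  show ?thesis (is "_ \<longleftrightarrow> ?table")
  proof
    assume "alg_length = 1"
    then have quad: "mult a a \<in> span {one, a}" for a
      using alg_length_1_iff_quadratic[OF dim] by blast
    obtain b0 where "b0 \<notin> span {one}"
      using span_two_proper[OF dim, of one one] by auto
    then obtain b d where b: "b \<notin> span {one}" "d \<in> {0, 1}" "eqv (mult b b) (scale d b)"
      using normalized_outside[OF quad] by blast
    obtain c0 where "c0 \<notin> span {one, b}"
      using span_two_proper[OF dim, of one b] by auto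
    then obtain c e where c: "c \<notin> span {one, b}" "e \<in> {0, 1}" "eqv (mult c c) (scale e c)"
      using normalized_outside[OF quad] by blast
    note basis = basis_one_extend[OF dim b(1) c(1)]
    then have full: "span {one, b, c} = UNIV" by (simp add: is_basis_def)
    obtain p q' where bc: "eqv (mult b c) (scale p b + scale q' c)"
      using full in_span_basis_iff by blast
    obtain p' q where cb: "eqv (mult c b) (scale q c + scale p' b)"
      using full in_span_basis_iff by (metis UNIV_I add.commute)
    have "p + p' = e \<and> q + q' = d"
      using quadratic_iff_coefficients[OF assms(2) b(1) c(1) full b(3) c(3) bc cb] quad by blast
    then have coeff: "p + p' + e = 0" "q + q' + d = 0"
      unfolding neg by simp_all
    show ?table
      by (rule exI[of _ b], rule exI[of _ c], intro conjI, rule basis, rule basis,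
          rule bexI[OF _ b(2)], rule bexI[OF _ c(2)], intro conjI, rule b, rule c,
          rule exI[of _ p], rule exI[of _ p'], rule exI[of _ q], rule exI[of _ q'],
          intro conjI bc cb coeff)
  next
    assume ?table
    then obtain b c d e p p' q q' where
      basis: "distinct [one, b, c]" "is_basis {one, b, c}"
      and table: "eqv (mult b b) (scale d b)" "eqv (mult c c) (scale e c)"
        "eqv (mult b c) (scale p b + scale q' c)" "eqv (mult c b) (scale q c + scale p' b)"
      and coeff: "p + p' + e = 0" "q + q' + d = 0"
      by blast
    have full: "span {one, b, c} = UNIV" using basis(2) by (simp add: is_basis_def)
    have b: "b \<notin> span {one}"
    proof
      assume "b \<in> span {one}"
      then have "b \<in> span {one, c}" using span_mono[of "{one}" "{one, c}"] by auto
      then have "span {one, c} = UNIV" using full span_redundant[of b "{one, c}"]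
        by (simp add: insert_commute)
      then show False using span_two_proper[OF dim] by blast
    qed
    have c: "c \<notin> span {one, b}"
    proof
      assume "c \<in> span {one, b}"
      then have "span {one, b} = UNIV" using full span_redundant[of c "{one, b}"]
        by (simp add: insert_commute)
      then show False using span_two_proper[OF dim] by blast
    qed
    have "p + p' = e \<and> q + q' = d" using coeff by (simp add: neg)
    then show "alg_length = 1"
      using quadratic_iff_coefficients[OF assms(2) b c full table]
        alg_length_1_iff_quadratic[OF dim] by blast
  qed
qed

end
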